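(* Let $d\ge 1$ and let $X\in\mathbb{R}^d$ be a generalized hyperbolic random vector, i.e. $$X=\mu+\sigma^2\Delta\beta+\sigma\Delta^{1/2}\zeta,$$ where $\mu,\beta\in\mathbb{R}^d$ are deterministic vectors, $\Delta$ is a deterministic $d\times d$ symmetric positive definite matrix with determinant $|\Delta|=1$, $\zeta$ is a standard Gaussian vector in $\mathbb{R}^d$, and $\sigma^2$ (with $\sigma>0$) is a scalar random variable, independent of $\zeta$, following the Generalized Inverse Gaussian distribution $GIG(\psi,\chi,\lambda)$ with parameters $\psi>0$, $\chi>0$, $\lambda\in\mathbb{R}$, i.e. with density $$f_{\psi,\chi,\lambda}(x)=\frac{(\psi/\chi)^{\lambda/2}}{2K_\lambda(\sqrt{\psi\chi})}\,x^{\lambda-1}\exp\left(-\tfrac12(\chi x^{-1}+\psi x)\right),\qquad x>0.$$ Let $A=\{\alpha_1,\dots,\alpha_{2N+\epsilon}\}$, with $\epsilon\in\{0,1\}$, be a set of integers (repetitions allowed) with $1\le\alpha_i\le d$ for all $i$. Then $$\mathbb{E}X_A=\sum_{\substack{0\le l\le N\\ 0\le p\le 2l+\epsilon}}\ \sum_{\substack{T\subset S\subset A\\ |T|=p,\ |S|=2l+\epsilon}}\mu_T\,\gamma_{S\backslash T}\,m_{N+l-p+\epsilon}\ \underset{A\backslash S}{\sum\prod}\,\mathbb{E}(Z_iZ_j),$$ where $\gamma=\Delta\beta$, $Z$ is a centered Gaussian vector in $\mathbb{R}^d$ with covariance matrix $\Delta$, and $$m_l=\mathbb{E}\sigma^{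2l}=\left(\frac{\psi}{\chi}\right)^{-l/2}\frac{K_{\lambda+l}(\sqrt{\psi\chi})}{K_\lambda(\sqrt{\psi\chi})}.$$
   Context: $K_\lambda$ denotes the modified Bessel function of the second kind of order $\lambda$. Multi-index notation: a "set" $A=\{\alpha_1,\dots,\alpha_n\}$ of integers with $1\le\alpha_i\le d$ is a finite indexed family in which the $\alpha_i$ need not be distinct. Subsets $T\subset S\subset A$, complements $A\backslash S$, $S\backslash T$, cardinalities and pairings are taken with respect to the positions $1,\dots,n$ (so repeated values count as different elements; e.g. a subset $S$ corresponds to a subset $I\subset\{1,\dots,n\}$, and $|S|=|I|$). For a vector $v\in\mathbb{R}^d$ (deterministic or random), $v_A=\prod_{i=1}^n v_{\alpha_i}$, with the convention $v_\emptyset=1$; similarly $v_S=\prod_{i\in I}v_{\alpha_i}$. A pairing of $A$ is a partition of (the positions of) $A$ into disjoint pairs; $\Pi(A)$ is the set of all pairings of $A$. It is empty if $|A|$ is odd, and for $A=\emptyset$ it consists of the single empty pairing. For a random vector $Y\in\mathbb{R}^d$, $$\underset{A}{\sum\prod}\,\mathbb{E}(Y_iY_j):=\sum_{\sigma\in\Pi(A)}\ \prod_{\{a,b\}\in\sigma}\mathbb{E}(Y_{\alpha_a}Y_{\alpha_b}),$$ i.e. the sum over all pairings of the product, over pairs of the pairing, of the second moments of the paired components (equal to $1$ when $A=\emptyset$); here $\sigma$ denotes a pairing and is unrelated to the random variable $\sigma$ of the claim. For example, $\underset{\{1,1,2,4\}}{\sum\prod}\mathbb{E}(Y_iY_j)=\mathbb{E}(Y_1^2)\mathbb{E}(Y_2Y_4)+2\,\mathbb{E}(Y_1Y_2)\mathbb{E}(Y_1Y_4)$.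 *)

theory Defs
  imports "HOL-Probability.Probability"
begin

text \<open>
  Modified Bessel function of the second kind of real order \<open>\<nu>\<close> at \<open>z > 0\<close>,
  by its standard integral representation
  \<open>K\<^sub>\<nu>(z) = \<integral>\<^sub>0\<^sup>\<infinity> exp (- z cosh t) cosh (\<nu> t) dt\<close> (DLMF 10.32.9).
\<close>

definition bessel_K :: "real \<Rightarrow> real \<Rightarrow> real" where
  "bessel_K \<nu> z = (LINT t:{0..}|lborel. exp (- z * cosh t) * cosh (\<nu> * t))"

definition gig_density :: "real \<Rightarrow> real \<Rightarrow> real \<Rightarrow> real \<Rightarrow> real" where
  "gig_density psi chi lam x =
     (if x > 0
      then (psi / chi) powr (lam / 2) / (2 * bessel_K lam (sqrt (psi * chi)))
             * x powr (lam - 1) * exp (- (1 / 2) * (chi * inverse x + psi * x))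
      else 0)"

definition gig_moment :: "real \<Rightarrow> real \<Rightarrow> real \<Rightarrow> nat \<Rightarrow> real" where
  "gig_moment psi chi lam l =
     (psi / chi) powr (- real l / 2)
       * (bessel_K (lam + real l) (sqrt (psi * chi)) / bessel_K lam (sqrt (psi * chi)))"

definition sym_pos_def :: "real ^ 'n ^ 'n \<Rightarrow> bool" where
  "sym_pos_def A \<longleftrightarrow> transpose A = A \<and> (\<forall>v. v \<noteq> 0 \<longrightarrow> v \<bullet> (A *v v) > 0)"

text \<open>The principal square root, well defined for symmetric positive definite matrices.\<close>

definition matrix_sqrt :: "real ^ 'n ^ 'n \<Rightarrow> real ^ 'n ^ 'n" where
  "matrix_sqrt A = (THE B. sym_pos_def B \<and> B ** B = A)"

text \<open>
  Counterpart of \<open>indep_var\<close> for random variables whose values are of different types.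
\<close>

definition indep_rvs ::
    "'a measure \<Rightarrow> 'b measure \<Rightarrow> ('a \<Rightarrow> 'b) \<Rightarrow> 'c measure \<Rightarrow> ('a \<Rightarrow> 'c) \<Rightarrow> bool" where
  "indep_rvs M S X T Y \<longleftrightarrow>
     X \<in> measurable M S \<and> Y \<in> measurable M T \<and>
     prob_space.indep_set M {X -` B \<inter> space M | B. B \<in> sets S} {Y -` B \<inter> space M | B. B \<in> sets T}"

definition standard_gaussian_vector :: "'a measure \<Rightarrow> ('a \<Rightarrow> real ^ 'n) \<Rightarrow> bool" where
  "standard_gaussian_vector M \<zeta> \<longleftrightarrow>
     prob_space.indep_vars M (\<lambda>_. borel) (\<lambda>i \<omega>. \<zeta> \<omega> $ i) UNIV \<and>
     (\<forall>i. distributed M lborel (\<lambda>\<omega>. \<zeta> \<omega> $ i) (\<lambda>x. ennreal (std_normal_density x)))"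

text \<open>
  A random vector is Gaussian if all its linear combinations are univariate Gaussian;
  constants count as Gaussians of variance zero.
\<close>

definition gaussian_vector :: "'a measure \<Rightarrow> ('a \<Rightarrow> real ^ 'n) \<Rightarrow> bool" where
  "gaussian_vector M Z \<longleftrightarrow>
     Z \<in> borel_measurable M \<and>
     (\<forall>u. (\<exists>m s. s > 0 \<and>
              distributed M lborel (\<lambda>\<omega>. u \<bullet> Z \<omega>) (\<lambda>x. ennreal (normal_density m s x))) \<or>
          (\<exists>c. AE \<omega> in M. u \<bullet> Z \<omega> = c))"

definition centered_gaussian_vector ::
    "'a measure \<Rightarrow> ('a \<Rightarrow> real ^ 'n) \<Rightarrow> real ^ 'n ^ 'n \<Rightarrow> bool" where
  "centered_gaussian_vector M Z C \<longleftrightarrow>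
     gaussian_vector M Z \<and>
     (\<forall>i. (LINT \<omega>|M. Z \<omega> $ i) = 0) \<and>
     (\<forall>i j. (LINT \<omega>|M. Z \<omega> $ i * Z \<omega> $ j) = C $ i $ j)"

text \<open>
  A family of component labels is given by \<open>\<alpha>\<close> on a finite set \<open>I\<close> of positions, so that
  repeated labels at different positions stay distinct; subsets and pairings refer to positions.
\<close>

definition comp_prod :: "(nat \<Rightarrow> 'n) \<Rightarrow> nat set \<Rightarrow> real ^ 'n \<Rightarrow> real" where
  "comp_prod \<alpha> I v = (\<Prod>i\<in>I. v $ \<alpha> i)"

definition pairings :: "nat set \<Rightarrow> nat set set set" where
  "pairings I = {P. partition_on I P \<and> (\<forall>B\<in>P. card B = 2)}"

text \<open>For a block \<open>B = {a, b}\<close> with \<open>a \<noteq> b\<close> the integrand is the product of the components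
  \<open>\<alpha> a\<close> and \<open>\<alpha> b\<close> of \<open>Y \<omega>\<close>.\<close>

definition pairing_sum ::
    "'a measure \<Rightarrow> ('a \<Rightarrow> real ^ 'n) \<Rightarrow> (nat \<Rightarrow> 'n) \<Rightarrow> nat set \<Rightarrow> real" where
  "pairing_sum M Y \<alpha> I = (\<Sum>P\<in>pairings I. \<Prod>B\<in>P. LINT \<omega>|M. comp_prod \<alpha> B (Y \<omega>))"

end

theory Submission
  imports Defs
begin

text \<open>
  Write \<open>B\<close> for the square root of \<open>\<Delta>\<close> and \<open>W = B \<zeta>\<close>, so that
  \<open>X = \<mu> + \<sigma>\<^sup>2 \<gamma> + \<sigma> W\<close>. Multiplying out the product of the components of \<open>X\<close>, every
  position chooses one of the three summands: the positions in \<open>T\<close> choose \<open>\<mu>\<close>, those in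
  \<open>S - T\<close> choose \<open>\<sigma>\<^sup>2 \<gamma>\<close>, and the remaining ones choose \<open>\<sigma> W\<close>
  (\<open>comp_prod_mixture_expand\<close>). As \<open>\<sigma>\<close> is almost surely the root of \<open>\<sigma>\<^sup>2\<close>, it is
  independent of \<open>W\<close>, and the expectation of each term is a constant times a moment of
  \<open>\<sigma>\<close> times the expectation of a product of components of \<open>W\<close>.

  The Gaussian factor is Isserlis' theorem (\<open>isserlis\<close>): it is a sum over pairings of
  products of covariances of \<open>W\<close>. Those covariances are the entries of \<open>B B\<^sup>T = \<Delta>\<close>,
  hence the second moments of \<open>Z\<close>. The identity
  \<open>B B\<^sup>T = \<Delta>\<close> presupposes that the definite description defining \<open>matrix_sqrt\<close> denotes, that
  is, existence and uniqueness of the positive definite root; both come from an orthonormal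
  eigenbasis (\<open>selfadjoint_orthonormal_eigenbasis\<close>).

  Since pairings of a set of odd size do not exist, only terms with \<open>A - S\<close> of even size
  survive, which is why the size of \<open>S\<close> runs through \<open>2 l + \<epsilon>\<close>. For those terms \<open>\<sigma>\<close> occurs with
  the even exponent \<open>2 (N + l + \<epsilon> - p)\<close>, so only integer moments of the generalized inverse
  Gaussian variable \<open>\<sigma>\<^sup>2\<close> are involved. The substitution \<open>x = sqrt (\<chi> / \<psi>) exp t\<close> turns its
  density into the integrand of the Bessel function and multiplication by \<open>x\<^sup>l\<close> into a shift
  of the order (\<open>gig_kernel_integral\<close>, \<open>gig_moments\<close>).
\<close>

section \<open>Self-adjoint operators and the square root of a positive definite matrix\<close>

text \<open>
  A maximizer \<open>v\<close> of the Rayleigh quotient on the unit sphere of \<open>S\<close> is an eigenvector. Indeed the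
  quadratic form \<open>q x = m (x \<bullet> x) - x \<bullet> f x\<close>, with \<open>m\<close> the maximum, is nonnegative on \<open>S\<close> and
  vanishes at \<open>v\<close>, so moving from \<open>v\<close> in the direction of the residual \<open>w = f v - m v\<close> cannot make
  it negative; its derivative in that direction is \<open>-2 (w \<bullet> w)\<close>, which forces \<open>w = 0\<close>.
\<close>

lemma selfadjoint_eigenvector:
  fixes f :: "'a::euclidean_space \<Rightarrow> 'a"
  assumes f: "linear f" and sa: "\<And>x y. f x \<bullet> y = x \<bullet> f y"
    and S: "subspace S" "f ` S \<subseteq> S" "S \<noteq> {0}"
  obtains v where "v \<in> S" "norm v = 1" "f v = (v \<bullet> f v) *\<^sub>R v"
proof -
  interpret f: linear f by (rule f)
  obtain x0 where x0: "x0 \<in> S" "x0 \<noteq> 0"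
    using S subspace_0 by blast
  have "compact (S \<inter> sphere 0 1)"
    using closed_subspace[OF S(1)] by (metis closed_Int_compact compact_sphere)
  moreover have "S \<inter> sphere 0 1 \<noteq> {}"
  proof -
    have "(1 / norm x0) *\<^sub>R x0 \<in> S \<inter> sphere 0 1"
      using x0 S by (auto simp: subspace_scale)
    then show ?thesis by blast
  qed
  moreover have "continuous_on (S \<inter> sphere 0 1) (\<lambda>x. x \<bullet> f x)"
    by (intro continuous_intros linear_continuous_on linear_conv_bounded_linear[THEN iffD1] f)
  ultimately have "\<exists>v\<in>S \<inter> sphere 0 1. \<forall>y\<in>S \<inter> sphere 0 1. y \<bullet> f y \<le> v \<bullet> f v"
    by (rule continuous_attains_sup)
  then obtain v where v: "v \<in> S" "norm v = 1"
    and max: "\<And>y. y \<in> S \<Longrightarrow> norm y = 1 \<Longrightarrow> y \<bullet> f y \<le> v \<bullet> f v"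
    by (force simp: sphere_def)
  define m where "m = v \<bullet> f v"
  define q where "q x = m * (x \<bullet> x) - x \<bullet> f x" for x
  have q_nonneg: "q x \<ge> 0" if "x \<in> S" for x
  proof (cases "x = 0")
    case True then show ?thesis by (simp add: q_def)
  next
    case False
    let ?y = "(1 / norm x) *\<^sub>R x"
    have "?y \<bullet> f ?y \<le> m"
      unfolding m_def using False that S by (intro max) (auto simp: subspace_scale)
    then have "(x \<bullet> f x) / (norm x)\<^sup>2 \<le> m"
      by (simp add: f.scaleR power2_eq_square)
    then show ?thesis
      using False by (simp add: q_def divide_le_eq power2_norm_eq_inner)
  qed
  define w where "w = f v - m *\<^sub>R v"
  have w: "w \<in> S"
    unfolding w_def using v S by (auto intro!: subspace_diff subspace_scale)
  have vv: "v \<bullet> v = 1" using v(2) by (simp add: norm_eq_1)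
  have q_line: "q (v + t *\<^sub>R w) = t\<^sup>2 * q w - 2 * t * (w \<bullet> w)" for t
  proof -
    have "v \<bullet> f w = w \<bullet> f v" using sa[of v w] by (simp add: inner_commute)
    moreover have "w \<bullet> f v = w \<bullet> w + m * (w \<bullet> v)"
      by (simp add: w_def inner_diff_right inner_diff_left)
    ultimately show ?thesis
      using vv m_def[symmetric] unfolding q_def
      by (simp add: f.add f.scaleR inner_add_left inner_add_right inner_commute[of v w]
          algebra_simps power2_eq_square)
  qed
  have "w \<bullet> w = 0"
  proof (rule ccontr)
    assume ne: "w \<bullet> w \<noteq> 0"
    then have pos: "w \<bullet> w > 0" by (metis inner_ge_zero order_le_less)
    have line: "t\<^sup>2 * q w - 2 * t * (w \<bullet> w) \<ge> 0" for t
      unfolding q_line[symmetric] by (intro q_nonneg subspace_add subspace_scale S v w)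
    show False
    proof (cases "q w = 0")
      case True then show ?thesis using line[of 1] pos by simp
    next
      case False
      then have "q w > 0" using q_nonneg[OF w] by simp
      \<comment> \<open>The minimum of the parabola in t lies at the chosen point and is negative.\<close>
      define a where "a = w \<bullet> w"
      have "(a / q w)\<^sup>2 * q w - 2 * (a / q w) * a = - (a * a / q w)"
        using \<open>q w > 0\<close> by (simp add: power2_eq_square)
      moreover have "a * a / q w > 0" using pos \<open>q w > 0\<close> by (simp add: a_def)
      ultimately show ?thesis using line[of "a / q w"] by (simp add: a_def)
    qed
  qed
  then show thesis using that[of v] v by (simp add: w_def m_def)
qed

text \<open>
  The spectral theorem, formulated for invariant subspaces so that the induction can split off an
  eigenvector \<open>v\<close> and continue with the orthogonal complement of \<open>v\<close> inside \<open>S\<close>, which is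
  again invariant because \<open>f\<close> is self-adjoint.
\<close>

lemma selfadjoint_orthonormal_eigenbasis:
  fixes f :: "'a::euclidean_space \<Rightarrow> 'a"
  assumes f: "linear f" and sa: "\<And>x y. f x \<bullet> y = x \<bullet> f y"
    and S: "subspace S" "f ` S \<subseteq> S"
  shows "\<exists>B. finite B \<and> pairwise orthogonal B \<and> span B = S \<and>
           (\<forall>b\<in>B. norm b = 1 \<and> f b = (b \<bullet> f b) *\<^sub>R b)"
  using S
proof (induction "dim S" arbitrary: S rule: less_induct)
  case less
  show ?case
  proof (cases "S = {0}")
    case True
    then show ?thesis by (intro exI[of _ "{}"]) auto
  next
    case False
    then obtain v where v: "v \<in> S" "norm v = 1" "f v = (v \<bullet> f v) *\<^sub>R v"
      using selfadjoint_eigenvector[OF f sa less.prems] by blast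
    have vv: "v \<bullet> v = 1" using v(2) by (simp add: norm_eq_1)
    define T where "T = S \<inter> {x. v \<bullet> x = 0}"
    have T: "subspace T"
      unfolding T_def by (intro subspace_inter less.prems subspace_hyperplane)
    have fT: "f ` T \<subseteq> T"
    proof safe
      fix x assume x: "x \<in> T"
      have "v \<bullet> f x = ((v \<bullet> f v) *\<^sub>R v) \<bullet> x" by (metis sa v(3))
      then show "f x \<in> T" using x less.prems by (auto simp: T_def)
    qed
    have "v \<notin> T" using vv by (simp add: T_def)
    then have "T \<subset> S" using v(1) unfolding T_def by blast
    then have "dim T < dim S"
      by (metis T dim_psubset less.prems(1) span_eq_iff)
    from less.hyps[OF this T fT] obtain B where B: "finite B" "pairwise orthogonal B" "span B = T"
      "\<forall>b\<in>B. norm b = 1 \<and> f b = (b \<bullet> f b) *\<^sub>R b" by blast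
    have orth: "v \<bullet> b = 0" if "b \<in> B" for b
      using span_base[OF that] B(3) by (auto simp: T_def)
    have "span (insert v B) = S"
    proof
      show "span (insert v B) \<subseteq> S"
        using v(1) B(3) less.prems(1) span_superset[of B]
        by (intro span_minimal) (auto simp: T_def)
      show "S \<subseteq> span (insert v B)"
      proof
        fix x assume "x \<in> S"
        then have "x - (v \<bullet> x) *\<^sub>R v \<in> T"
          using v less.prems(1) vv
          by (auto simp: T_def inner_diff_right intro!: subspace_diff subspace_scale)
        then show "x \<in> span (insert v B)"
          unfolding span_insert B(3) by blast
      qed
    qed
    moreover have "pairwise orthogonal (insert v B)"
      using B(2) orth by (auto simp: pairwise_insert orthogonal_def inner_commute)
    moreover have "finite (insert v B)" using B(1) by simp
    ultimately show ?thesis using B(4) v(2,3) by blast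
  qed
qed

lemma sym_pos_def_inner:
  assumes "sym_pos_def A"
  shows "(A *v x) \<bullet> y = x \<bullet> (A *v y)"
  using assms by (metis sym_pos_def_def dot_lmul_matrix vector_transpose_matrix)

text \<open>
  The root \<open>B\<close> acts on an orthonormal eigenbasis of \<open>A\<close> by the square roots of the eigenvalues.
  It is the only positive definite root: if \<open>C\<close> is another one and \<open>b\<close> an eigenvector of \<open>A\<close> with
  eigenvalue \<open>r\<close>, then \<open>(C + sqrt r) (C b - sqrt r b) = 0\<close>; here \<open>C + sqrt r\<close> is positive
  definite, hence injective, so \<open>C\<close> agrees with \<open>B\<close> on the basis.
\<close>

lemma
  fixes A :: "real ^ 'n ^ 'n"
  assumes A: "sym_pos_def A"
  shows sym_pos_def_matrix_sqrt: "sym_pos_def (matrix_sqrt A)"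
    and matrix_sqrt_mult_self: "matrix_sqrt A ** matrix_sqrt A = A"
proof -
  have pos: "v \<bullet> (A *v v) > 0" if "v \<noteq> 0" for v
    using A that by (auto simp: sym_pos_def_def)
  have "linear ((*v) A)" by (rule matrix_vector_mul_linear)
  from selfadjoint_orthonormal_eigenbasis[OF this sym_pos_def_inner[OF A] subspace_UNIV]
  obtain E where E: "finite E" "pairwise orthogonal E" "span E = UNIV"
    "\<And>b. b \<in> E \<Longrightarrow> norm b = 1" "\<And>b. b \<in> E \<Longrightarrow> A *v b = (b \<bullet> (A *v b)) *\<^sub>R b"
    by auto
  define ev where "ev b = b \<bullet> (A *v b)" for b
  have ev: "ev b > 0" if "b \<in> E" for b
    using E(4)[OF that] unfolding ev_def by (intro pos) auto
  have expand: "(\<Sum>b\<in>E. (x \<bullet> b) *\<^sub>R b) = x" for x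
    using E by (intro orthonormal_basis_expand) auto
  have ortho: "b \<bullet> c = (if b = c then 1 else 0)" if "b \<in> E" "c \<in> E" for b c
    using that E(2,4) by (auto simp: pairwise_def orthogonal_def norm_eq_1)
  define g where "g x = (\<Sum>b\<in>E. (sqrt (ev b) * (x \<bullet> b)) *\<^sub>R b)" for x
  have g_inner: "g x \<bullet> b = sqrt (ev b) * (x \<bullet> b)" if "b \<in> E" for x b
    using that E(1) unfolding g_def by (simp add: inner_sum_left ortho if_distrib cong: if_cong)
  have lin: "linear g"
    unfolding g_def by (rule linearI)
      (simp_all add: inner_add_left algebra_simps sum.distrib scaleR_sum_right)
  define B where "B = matrix g"
  have B: "B *v x = g x" for x
    unfolding B_def using lin by (simp add: matrix_works)
  have B_sq: "B ** B = A"
  proof -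
    have "B *v (B *v x) = A *v x" for x
    proof -
      have "B *v (B *v x) = (\<Sum>b\<in>E. (x \<bullet> b) *\<^sub>R (ev b *\<^sub>R b))"
        unfolding B g_def[of "g x"] using g_inner ev
        by (intro sum.cong refl) (simp add: less_imp_le ac_simps)
      also have "\<dots> = (\<Sum>b\<in>E. (x \<bullet> b) *\<^sub>R (A *v b))"
        using E(5) by (intro sum.cong refl) (simp add: ev_def)
      also have "\<dots> = A *v (\<Sum>b\<in>E. (x \<bullet> b) *\<^sub>R b)"
        by (simp add: linear_sum[OF matrix_vector_mul_linear] matrix_vector_mult_scaleR)
      finally show ?thesis by (simp add: expand)
    qed
    then show ?thesis by (simp add: matrix_eq matrix_vector_mul_assoc[symmetric])
  qed
  have B_spd: "sym_pos_def B"
    unfolding sym_pos_def_def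
  proof (intro conjI allI impI)
    have g_sa: "g x \<bullet> y = x \<bullet> g y" for x y
      unfolding g_def by (simp add: inner_sum_left inner_sum_right inner_commute ac_simps)
    have "transpose B *v x = B *v x" for x
    proof -
      have "(transpose B *v x) \<bullet> y = (B *v x) \<bullet> y" for y
        by (metis B dot_lmul_matrix g_sa vector_transpose_matrix transpose_transpose)
      then show ?thesis by (metis vector_eq_rdot)
    qed
    then show "transpose B = B" by (simp add: matrix_eq)
  next
    fix v :: "real ^ 'n" assume "v \<noteq> 0"
    then obtain b where b: "b \<in> E" "v \<bullet> b \<noteq> 0"
      using expand[of v] by (metis (no_types, lifting) scale_eq_0_iff sum.neutral)
    have "v \<bullet> (B *v v) = (\<Sum>b\<in>E. sqrt (ev b) * (v \<bullet> b)\<^sup>2)"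
      unfolding B g_def by (simp add: inner_sum_right power2_eq_square mult.assoc)
    also have "\<dots> > 0"
      using b ev[OF b(1)] ev[THEN less_imp_le] E(1) by (intro sum_pos2[OF _ b(1)]) auto
    finally show "v \<bullet> (B *v v) > 0" .
  qed
  have unique: "C = B" if C: "sym_pos_def C" "C ** C = A" for C
  proof -
    have Cb: "C *v b = sqrt (ev b) *\<^sub>R b" if b: "b \<in> E" for b
    proof (rule ccontr)
      assume ne: "C *v b \<noteq> sqrt (ev b) *\<^sub>R b"
      define w where "w = C *v b - sqrt (ev b) *\<^sub>R b"
      have "C *v (C *v b) = ev b *\<^sub>R b"
        using C(2) E(5)[OF b] by (simp add: matrix_vector_mul_assoc ev_def)
      then have "C *v w = - (sqrt (ev b) *\<^sub>R w)"
        using ev[OF b]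
        by (simp add: w_def matrix_vector_mult_diff_distrib matrix_vector_mult_scaleR
            scaleR_diff_right)
      moreover have "w \<bullet> (C *v w) > 0"
        using C(1) ne by (auto simp: sym_pos_def_def w_def)
      moreover have "sqrt (ev b) * (w \<bullet> w) \<ge> 0"
        using ev[OF b] by simp
      ultimately show False by simp
    qed
    have "C *v x = B *v x" for x
    proof -
      have "C *v x = (\<Sum>b\<in>E. (x \<bullet> b) *\<^sub>R (C *v b))"
        by (subst expand[of x, symmetric]) (simp add: linear_sum[OF matrix_vector_mul_linear] matrix_vector_mult_scaleR)
      also have "\<dots> = B *v x" unfolding B g_def
        by (intro sum.cong refl) (simp add: Cb)
      finally show ?thesis .
    qed
    then show ?thesis by (simp add: matrix_eq)
  qed
  have "\<exists>!B. sym_pos_def B \<and> B ** B = A"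
    using B_spd B_sq unique by blast
  from theI'[OF this] have "sym_pos_def (matrix_sqrt A) \<and> matrix_sqrt A ** matrix_sqrt A = A"
    unfolding matrix_sqrt_def .
  then show "sym_pos_def (matrix_sqrt A)" and "matrix_sqrt A ** matrix_sqrt A = A" by auto
qed

section \<open>Pairings\<close>

lemma finite_pairings: "finite I \<Longrightarrow> finite (pairings I)"
  by (rule finite_subset[of _ "Pow (Pow I)"]) (auto simp: pairings_def partition_on_def)

lemma pairings_empty: "pairings {} = {{}}"
  by (auto simp: pairings_def partition_on_empty)

text \<open>
  A pairing is determined by the partner \<open>j\<close> of a distinguished position \<open>i\<close> and a pairing of
  what is left.
\<close>

lemma pairings_eq_Union:
  assumes i: "i \<in> I"
  shows "pairings I = (\<Union>j\<in>I - {i}. insert {i, j} ` pairings (I - {i, j}))"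
proof (intro equalityI subsetI)
  fix P assume P: "P \<in> pairings I"
  then have part: "partition_on I P" and card2: "\<And>B. B \<in> P \<Longrightarrow> card B = 2"
    by (auto simp: pairings_def)
  obtain B where B: "B \<in> P" "i \<in> B"
    using part i by (auto simp: partition_on_def)
  then obtain j where j: "B = {i, j}" "j \<noteq> i"
    using card2[OF B(1)] by (auto simp: card_2_iff)
  have jI: "j \<in> I" using part B j by (auto simp: partition_on_def)
  have eq: "P = insert {i, j} (P - {{i, j}})" using B j by auto
  have disj: "disjnt {i, j} (\<Union>(P - {{i, j}}))"
    using pairwiseD[OF partition_onD2[OF part] B(1)] unfolding j(1) disjnt_Union2
    by (metis DiffE singletonI)
  have "partition_on (I - {i, j}) (P - {{i, j}})"
    using part partition_on_insert[OF disj] eq by metis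
  then have "P - {{i, j}} \<in> pairings (I - {i, j})"
    using card2 by (auto simp: pairings_def)
  then show "P \<in> (\<Union>j\<in>I - {i}. insert {i, j} ` pairings (I - {i, j}))"
    using jI j eq by blast
next
  fix P assume "P \<in> (\<Union>j\<in>I - {i}. insert {i, j} ` pairings (I - {i, j}))"
  then obtain j Q where j: "j \<in> I" "j \<noteq> i" and Q: "Q \<in> pairings (I - {i, j})"
    and P: "P = insert {i, j} Q" by blast
  have part: "partition_on (I - {i, j}) Q" using Q by (simp add: pairings_def)
  then have "disjnt {i, j} (\<Union>Q)" by (auto simp: partition_on_def disjnt_iff)
  from partition_on_insert[OF this, of I] part i j Q
  show "P \<in> pairings I" by (auto simp: pairings_def P)
qed

text \<open>
  This recursion is the form in which pairings enter Isserlis' theorem: sums of products over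
  pairings are treated by induction on the number of positions. In each summand \<open>i\<close>
  occurs only in the block \<open>{i, j}\<close>, so linearity of \<open>h\<close> in what sits at
  position \<open>i\<close> is inherited by the whole sum.
\<close>

lemma sum_pairings_rec:
  fixes h :: "nat set \<Rightarrow> 'c::comm_semiring_1"
  assumes I: "finite I" and i: "i \<in> I"
  shows "(\<Sum>P\<in>pairings I. \<Prod>B\<in>P. h B) =
         (\<Sum>j\<in>I - {i}. h {i, j} * (\<Sum>P\<in>pairings (I - {i, j}). \<Prod>B\<in>P. h B))"
proof -
  have fresh: "{i, j} \<notin> Q" "finite Q" if "Q \<in> pairings (I - {i, j})" for j Q
  proof -
    have part: "partition_on (I - {i, j}) Q" using that by (simp add: pairings_def)
    show "{i, j} \<notin> Q" using part by (auto simp: partition_on_def)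
    show "finite Q" by (rule finite_elements[OF _ part]) (simp add: I)
  qed
  have "(\<Sum>P\<in>pairings I. \<Prod>B\<in>P. h B) =
        (\<Sum>j\<in>I - {i}. \<Sum>P\<in>insert {i, j} ` pairings (I - {i, j}). \<Prod>B\<in>P. h B)"
    unfolding pairings_eq_Union[OF i]
  proof (intro sum.UNION_disjoint ballI impI)
    fix j k assume jk: "j \<in> I - {i}" "k \<in> I - {i}" "j \<noteq> k"
    show "insert {i, j} ` pairings (I - {i, j}) \<inter> insert {i, k} ` pairings (I - {i, k}) = {}"
    proof (rule ccontr)
      assume "\<not> ?thesis"
      then obtain Q R where QR: "Q \<in> pairings (I - {i, j})" "R \<in> pairings (I - {i, k})"
        "insert {i, j} Q = insert {i, k} R" by blast
      have "{i, j} \<noteq> {i, k}" using jk by (auto simp: doubleton_eq_iff)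
      then have "{i, j} \<in> R" using QR(3) by blast
      then show False using QR(2) by (auto simp: pairings_def partition_on_def)
    qed
  qed (use I in \<open>auto intro: finite_pairings\<close>)
  also have "\<dots> = (\<Sum>j\<in>I - {i}. h {i, j} * (\<Sum>P\<in>pairings (I - {i, j}). \<Prod>B\<in>P. h B))"
  proof (intro sum.cong refl)
    fix j
    have "inj_on (insert {i, j}) (pairings (I - {i, j}))"
      using fresh by (intro inj_onI) (metis insert_ident)
    then have "(\<Sum>P\<in>insert {i, j} ` pairings (I - {i, j}). \<Prod>B\<in>P. h B) =
        (\<Sum>Q\<in>pairings (I - {i, j}). \<Prod>B\<in>insert {i, j} Q. h B)"
      by (simp add: sum.reindex)
    also have "\<dots> = (\<Sum>Q\<in>pairings (I - {i, j}). h {i, j} * (\<Prod>B\<in>Q. h B))"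
      using fresh by (intro sum.cong refl prod.insert) auto
    finally show "(\<Sum>P\<in>insert {i, j} ` pairings (I - {i, j}). \<Prod>B\<in>P. h B) =
        h {i, j} * (\<Sum>P\<in>pairings (I - {i, j}). \<Prod>B\<in>P. h B)"
      by (simp add: sum_distrib_left)
  qed
  finally show ?thesis .
qed

lemma pairings_odd:
  assumes "finite I" "odd (card I)"
  shows "pairings I = {}"
proof (rule ccontr)
  assume "pairings I \<noteq> {}"
  then obtain P where P: "partition_on I P" "\<forall>B\<in>P. card B = 2" by (auto simp: pairings_def)
  have "card I = (\<Sum>B\<in>P. card B)"
    using card_Union_disjoint[OF partition_onD2[OF P(1)]] partition_onD1[OF P(1)] assms(1)
    by (metis Union_upper finite_subset)
  also have "\<dots> = 2 * card P" using P by simp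
  finally show False using assms by simp
qed

section \<open>Isserlis' theorem\<close>

text \<open>
  Integration by parts against the standard normal density; it is read off here from the closed
  form of the moments. For \<open>m = 0\<close> the truncated exponent \<open>m - 1\<close> is harmless, the factor being zero.
\<close>

lemma std_normal_moment_rec:
  "(LINT x|lborel. std_normal_density x * x ^ (Suc m)) =
     real m * (LINT x|lborel. std_normal_density x * x ^ (m - 1))"
proof (cases "even m")
  case True
  then obtain k where "m = 2 * k" by blast
  then show ?thesis
    using integral_std_normal_moment_odd[of k] integral_std_normal_moment_odd[of "k - 1"]
    by (cases k) simp_all
next
  case False
  then obtain k where k: "m = 2 * k + 1" by (blast elim: oddE)
  have "(LINT x|lborel. std_normal_density x * x ^ (Suc m)) = fact (2 * Suc k) / (2 ^ Suc k * fact (Suc k))"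
    using integral_std_normal_moment_even[of "Suc k"] k by simp
  also have "\<dots> = real m * (fact (2 * k) / (2 ^ k * fact k))"
  proof -
    have "fact (2 * Suc k) = real (2 * Suc k) * (real m * fact (2 * k))"
      unfolding k by (simp add: mult.assoc)
    then show ?thesis by (simp add: divide_simps)
  qed
  finally show ?thesis using integral_std_normal_moment_even[of k] k by simp
qed

context prob_space begin

lemma standard_gaussian_component_moment:
  fixes \<zeta> :: "'a \<Rightarrow> real ^ 'n"
  assumes z: "standard_gaussian_vector M \<zeta>"
  shows "integrable M (\<lambda>\<omega>. (\<zeta> \<omega> $ k) ^ n)"
    and "expectation (\<lambda>\<omega>. (\<zeta> \<omega> $ k) ^ n) = (LINT x|lborel. std_normal_density x * x ^ n)"
proof -
  have D: "distributed M lborel (\<lambda>\<omega>. \<zeta> \<omega> $ k) (\<lambda>x. ennreal (std_normal_density x))"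
    using z by (simp add: standard_gaussian_vector_def)
  show "integrable M (\<lambda>\<omega>. (\<zeta> \<omega> $ k) ^ n)"
    using distributed_integrable[OF D, of "\<lambda>x. x ^ n"] integrable_std_normal_moment[of n] by simp
  show "expectation (\<lambda>\<omega>. (\<zeta> \<omega> $ k) ^ n) = (LINT x|lborel. std_normal_density x * x ^ n)"
    using distributed_integral[OF D, of "\<lambda>x. x ^ n"] by simp
qed

text \<open>
  Grouping the factors by the component that they involve makes independence applicable.
\<close>

lemma standard_gaussian_monomial:
  fixes \<zeta> :: "'a \<Rightarrow> real ^ 'n"
  assumes z: "standard_gaussian_vector M \<zeta>" and J: "finite J"
  shows "integrable M (\<lambda>\<omega>. \<Prod>j\<in>J. \<zeta> \<omega> $ \<kappa> j)"
    and "expectation (\<lambda>\<omega>. \<Prod>j\<in>J. \<zeta> \<omega> $ \<kappa> j) =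
           (\<Prod>k\<in>UNIV. LINT x|lborel. std_normal_density x * x ^ card {j \<in> J. \<kappa> j = k})"
proof -
  have eq: "(\<Prod>j\<in>J. \<zeta> \<omega> $ \<kappa> j) = (\<Prod>k\<in>UNIV. (\<zeta> \<omega> $ k) ^ card {j \<in> J. \<kappa> j = k})" for \<omega>
  proof -
    have "(\<Prod>j\<in>J. \<zeta> \<omega> $ \<kappa> j) = (\<Prod>k\<in>UNIV. \<Prod>j\<in>{j \<in> J. \<kappa> j = k}. \<zeta> \<omega> $ \<kappa> j)"
      using J by (intro prod.group[symmetric]) auto
    then show ?thesis by simp
  qed
  have indep: "indep_vars (\<lambda>_. borel) (\<lambda>k \<omega>. (\<zeta> \<omega> $ k) ^ card {j \<in> J. \<kappa> j = k}) UNIV"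
    using z unfolding standard_gaussian_vector_def
    by (intro indep_vars_compose2[where M'="\<lambda>_. borel" and X="\<lambda>k \<omega>. \<zeta> \<omega> $ k"
          and Y="\<lambda>k x. x ^ card {j \<in> J. \<kappa> j = k}"]) auto
  note int = standard_gaussian_component_moment[OF z]
  show "integrable M (\<lambda>\<omega>. \<Prod>j\<in>J. \<zeta> \<omega> $ \<kappa> j)"
    unfolding eq by (intro indep_vars_integrable indep int) auto
  show "expectation (\<lambda>\<omega>. \<Prod>j\<in>J. \<zeta> \<omega> $ \<kappa> j) =
           (\<Prod>k\<in>UNIV. LINT x|lborel. std_normal_density x * x ^ card {j \<in> J. \<kappa> j = k})"
    unfolding eq by (subst indep_vars_lebesgue_integral[OF _ indep int(1)]) (auto simp: int(2))
qed

lemma standard_gaussian_covariance: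
  fixes \<zeta> :: "'a \<Rightarrow> real ^ 'n"
  assumes z: "standard_gaussian_vector M \<zeta>"
  shows "integrable M (\<lambda>\<omega>. \<zeta> \<omega> $ k * \<zeta> \<omega> $ l)"
    and "expectation (\<lambda>\<omega>. \<zeta> \<omega> $ k * \<zeta> \<omega> $ l) = (if k = l then 1 else 0)"
proof -
  define \<kappa> where "\<kappa> j = (if j = 0 then k else l)" for j :: nat
  have prod: "(\<Prod>j\<in>{0, 1}. \<zeta> \<omega> $ \<kappa> j) = \<zeta> \<omega> $ k * \<zeta> \<omega> $ l" for \<omega>
    by (simp add: \<kappa>_def)
  note mono = standard_gaussian_monomial[OF z, of "{0, 1}" \<kappa>, unfolded prod]
  show "integrable M (\<lambda>\<omega>. \<zeta> \<omega> $ k * \<zeta> \<omega> $ l)" using mono(1) by simp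
  show "expectation (\<lambda>\<omega>. \<zeta> \<omega> $ k * \<zeta> \<omega> $ l) = (if k = l then 1 else 0)"
  proof (cases "k = l")
    case True
    then show ?thesis
      using standard_gaussian_component_moment(2)[OF z, of l 2] integral_std_normal_moment_even[of 1]
      by (simp add: power2_eq_square)
  next
    case False
    then have "{j \<in> {0, 1}. \<kappa> j = k} = {0}" by (auto simp: \<kappa>_def)
    then have "(LINT x|lborel. std_normal_density x * x ^ card {j \<in> {0, 1}. \<kappa> j = k}) = 0"
      using integral_std_normal_moment_odd[of 0] by simp
    then have "(\<Prod>m\<in>UNIV. LINT x|lborel. std_normal_density x * x ^ card {j \<in> {0, 1}. \<kappa> j = m}) = 0"
      by (metis (no_types, lifting) finite UNIV_I prod_zero)
    then show ?thesis using mono(2) False by simp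
  qed
qed

text \<open>
  The recursion of \<open>sum_pairings_rec\<close> for moments of coordinates. If \<open>m\<close> further positions
  carry the same label as \<open>i\<close>, then the corresponding component occurs with exponent \<open>m + 1\<close>, and the
  one-dimensional recursion replaces its moment by \<open>m\<close> times the moment of order \<open>m - 1\<close>. These
  are the \<open>m\<close> partners \<open>j\<close> with nonzero covariance, and removing any of them together with \<open>i\<close>
  leaves the same monomial.
\<close>

lemma standard_gaussian_monomial_rec:
  fixes \<zeta> :: "'a \<Rightarrow> real ^ 'n"
  assumes z: "standard_gaussian_vector M \<zeta>" and J: "finite J" and i: "i \<in> J"
  shows "expectation (\<lambda>\<omega>. \<Prod>j\<in>J. \<zeta> \<omega> $ \<kappa> j) =
     (\<Sum>j\<in>J - {i}. expectation (\<lambda>\<omega>. \<Prod>b\<in>{i, j}. \<zeta> \<omega> $ \<kappa> b) *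
        expectation (\<lambda>\<omega>. \<Prod>b\<in>J - {i, j}. \<zeta> \<omega> $ \<kappa> b))"
proof -
  define g where "g n = (LINT x|lborel. std_normal_density x * x ^ n)" for n
  define n where "n K k = card {j \<in> K. \<kappa> j = k}" for K k
  have E: "expectation (\<lambda>\<omega>. \<Prod>j\<in>K. \<zeta> \<omega> $ \<kappa> j) = (\<Prod>k\<in>UNIV. g (n K k))" if "finite K" for K
    using standard_gaussian_monomial(2)[OF z that] by (simp add: g_def n_def)
  have g_rec: "g (Suc m) = real m * g (m - 1)" for m
    unfolding g_def by (rule std_normal_moment_rec)
  have pair: "expectation (\<lambda>\<omega>. \<Prod>b\<in>{i, j}. \<zeta> \<omega> $ \<kappa> b) = (if \<kappa> j = \<kappa> i then 1 else 0)"
    if "j \<in> J - {i}" for j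
    using that standard_gaussian_covariance(2)[OF z, of "\<kappa> i" "\<kappa> j"] by auto
  let ?S = "{j \<in> J - {i}. \<kappa> j = \<kappa> i}"
  define m where "m = card ?S"
  define R where "R = (\<Prod>k\<in>UNIV - {\<kappa> i}. g (n J k))"
  have "{j \<in> J. \<kappa> j = \<kappa> i} = insert i ?S" using i by auto
  then have n_i: "n J (\<kappa> i) = Suc m" using J by (simp add: n_def m_def)
  have rest: "expectation (\<lambda>\<omega>. \<Prod>b\<in>J - {i, j}. \<zeta> \<omega> $ \<kappa> b) = g (m - 1) * R" if j: "j \<in> ?S" for j
  proof -
    have "{b \<in> J - {i, j}. \<kappa> b = \<kappa> i} = ?S - {j}" by auto
    then have "n (J - {i, j}) (\<kappa> i) = m - 1"
      using j J by (simp add: n_def m_def)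
    moreover have "n (J - {i, j}) k = n J k" if "k \<noteq> \<kappa> i" for k
      using that j unfolding n_def by (intro arg_cong[where f=card]) auto
    ultimately show ?thesis
      using J by (simp add: E prod.remove[of UNIV "\<kappa> i"] R_def)
  qed
  have "(\<Sum>j\<in>J - {i}. expectation (\<lambda>\<omega>. \<Prod>b\<in>{i, j}. \<zeta> \<omega> $ \<kappa> b) *
        expectation (\<lambda>\<omega>. \<Prod>b\<in>J - {i, j}. \<zeta> \<omega> $ \<kappa> b)) = (\<Sum>j\<in>?S. g (m - 1) * R)"
    using J by (intro sum.mono_neutral_cong_right) (auto simp: pair rest)
  also have "\<dots> = g (Suc m) * R" by (simp add: m_def g_rec)
  also have "\<dots> = expectation (\<lambda>\<omega>. \<Prod>j\<in>J. \<zeta> \<omega> $ \<kappa> j)"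
    using J by (simp add: E prod.remove[of UNIV "\<kappa> i"] R_def n_i)
  finally show ?thesis by simp
qed

end

text \<open>
  The argument by multilinearity: a property of families of vectors that holds for families of
  coordinate vectors, and that passes from \<open>v(i := axis k 1)\<close> for all \<open>k\<close> to \<open>v\<close>, holds
  always. The entries that are not coordinate vectors are replaced one at a time.
\<close>

lemma multilinear_basis_induct [consumes 1, case_names basis expand]:
  fixes Q :: "('i \<Rightarrow> real ^ 'n) \<Rightarrow> bool" and v :: "'i \<Rightarrow> real ^ 'n"
  assumes I: "finite I"
    and basis: "\<And>v \<kappa>. (\<And>i. i \<in> I \<Longrightarrow> v i = axis (\<kappa> i) 1) \<Longrightarrow> Q v"
    and expand: "\<And>v i. i \<in> I \<Longrightarrow> (\<And>k. Q (v(i := axis k 1))) \<Longrightarrow> Q v"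
  shows "Q v"
proof -
  have "\<forall>v. (\<forall>i\<in>I - K. \<exists>k. v i = axis k 1) \<longrightarrow> Q v" if "finite K" "K \<subseteq> I" for K
    using that
  proof (induction K)
    case empty
    show ?case
    proof (intro allI impI)
      fix v :: "'i \<Rightarrow> real ^ 'n" assume "\<forall>i\<in>I - {}. \<exists>k. v i = axis k 1"
      then obtain \<kappa> where "\<forall>i\<in>I. v i = axis (\<kappa> i) 1" by (auto simp: bchoice_iff)
      then show "Q v" by (intro basis) auto
    qed
  next
    case (insert i K)
    show ?case
    proof (intro allI impI)
      fix v :: "'i \<Rightarrow> real ^ 'n" assume v: "\<forall>j\<in>I - insert i K. \<exists>k. v j = axis k 1"
      show "Q v"
      proof (rule expand[of i])
        show "i \<in> I" using insert.prems by simp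
        show "Q (v(i := axis k 1))" for k
        proof -
          have "\<forall>j\<in>I - K. \<exists>l. (v(i := axis k 1)) j = axis l 1" using v by auto
          then show ?thesis using insert by blast
        qed
      qed
    qed
  qed
  from this[OF I] show ?thesis by simp
qed

context prob_space begin

text \<open>
  Isserlis' theorem. Both sides are linear in each \<open>v i\<close>: the left one because the expectation is
  linear, the right one by \<open>sum_pairings_rec\<close> at the position \<open>i\<close>. It therefore suffices
  to treat coordinate vectors, for which both sides obey the same recursion. Keeping the block
  factors as expectations, instead of inner products, makes them depend on \<open>v\<close> in the same way as
  the left-hand side, so that one expansion lemma serves both.
\<close>

lemma
  fixes \<zeta> :: "'a \<Rightarrow> real ^ 'n" and v :: "nat \<Rightarrow> real ^ 'n"
  assumes z: "standard_gaussian_vector M \<zeta>" and I: "finite I"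
  shows integrable_gaussian_linear_forms: "integrable M (\<lambda>\<omega>. \<Prod>i\<in>I. v i \<bullet> \<zeta> \<omega>)"
    and isserlis: "expectation (\<lambda>\<omega>. \<Prod>i\<in>I. v i \<bullet> \<zeta> \<omega>) =
      (\<Sum>P\<in>pairings I. \<Prod>B\<in>P. expectation (\<lambda>\<omega>. \<Prod>b\<in>B. v b \<bullet> \<zeta> \<omega>))"
proof -
  have prod_expand: "(\<Prod>j\<in>J. v j \<bullet> \<zeta> \<omega>) = (\<Sum>k\<in>UNIV. v i $ k * (\<Prod>j\<in>J. (v(i := axis k 1)) j \<bullet> \<zeta> \<omega>))"
    if "finite J" "i \<in> J" for J i \<omega> and v :: "nat \<Rightarrow> real ^ 'n"
  proof -
    have *: "(\<Prod>j\<in>J - {i}. (v(i := axis k 1)) j \<bullet> \<zeta> \<omega>) = (\<Prod>j\<in>J - {i}. v j \<bullet> \<zeta> \<omega>)" for k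
      by (intro prod.cong) auto
    show ?thesis
      unfolding prod.remove[OF that] *
      by (simp add: inner_axis' inner_vec_def[of "v i"] sum_distrib_right mult.assoc)
  qed
  have int: "integrable M (\<lambda>\<omega>. \<Prod>i\<in>J. v i \<bullet> \<zeta> \<omega>)" if "finite J" for J and v :: "nat \<Rightarrow> real ^ 'n"
    using that
  proof (induction v rule: multilinear_basis_induct)
    case (basis v \<kappa>)
    then show ?case
      using standard_gaussian_monomial(1)[OF z that, of \<kappa>] by (simp add: inner_axis')
  next
    case (expand v i)
    have "(\<lambda>\<omega>. \<Prod>j\<in>J. v j \<bullet> \<zeta> \<omega>) =
        (\<lambda>\<omega>. \<Sum>k\<in>UNIV. v i $ k * (\<Prod>j\<in>J. (v(i := axis k 1)) j \<bullet> \<zeta> \<omega>))"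
      by (rule ext) (rule prod_expand[OF that expand(1)])
    then show ?case
      by (simp only:) (intro Bochner_Integration.integrable_sum integrable_mult_right expand(2))
  qed
  show "integrable M (\<lambda>\<omega>. \<Prod>i\<in>I. v i \<bullet> \<zeta> \<omega>)" by (rule int[OF I])
  define E where "E v J = expectation (\<lambda>\<omega>. \<Prod>b\<in>J. v b \<bullet> \<zeta> \<omega>)" for v :: "nat \<Rightarrow> real ^ 'n" and J
  define W where "W v J = (\<Sum>P\<in>pairings J. \<Prod>B\<in>P. E v B)" for v J
  have E_expand: "E v J = (\<Sum>k\<in>UNIV. v i $ k * E (v(i := axis k 1)) J)"
    if "finite J" "i \<in> J" for J i v
    unfolding E_def prod_expand[OF that, of v]
    by (subst Bochner_Integration.integral_sum) (auto intro!: int[OF that(1)] simp del: fun_upd_apply)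
  have E_cong: "E v J = E w J" if "\<And>j. j \<in> J \<Longrightarrow> v j = w j" for v w J
    using that by (simp add: E_def)
  have W_rec: "W v J = (\<Sum>j\<in>J - {i}. E v {i, j} * W v (J - {i, j}))"
    if "finite J" "i \<in> J" for v J i
    unfolding W_def by (rule sum_pairings_rec[OF that])
  have W_cong: "W v J = W w J" if "\<And>j. j \<in> J \<Longrightarrow> v j = w j" for v w J
    unfolding W_def using that
    by (intro sum.cong prod.cong E_cong refl) (auto simp: pairings_def partition_on_def)
  have W_expand: "W v J = (\<Sum>k\<in>UNIV. v i $ k * W (v(i := axis k 1)) J)"
    if J: "finite J" "i \<in> J" for J i v
  proof -
    have *: "W (v(i := axis k 1)) (J - {i, j}) = W v (J - {i, j})" for k j
      by (intro W_cong) auto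
    have "W v J = (\<Sum>j\<in>J - {i}. (\<Sum>k\<in>UNIV. v i $ k * E (v(i := axis k 1)) {i, j}) * W v (J - {i, j}))"
      unfolding W_rec[OF J] by (subst (1) E_expand[of _ i]) auto
    also have "\<dots> = (\<Sum>k\<in>UNIV. v i $ k * W (v(i := axis k 1)) J)"
      unfolding W_rec[OF J] *
      by (simp add: sum_distrib_left sum_distrib_right mult.assoc) (rule sum.swap)
    finally show ?thesis .
  qed
  have "E v J = W v J" if "finite J" for J
    using that
  proof (induction J arbitrary: v rule: finite_psubset_induct)
    case (psubset J)
    from psubset(1) show ?case
    proof (induction v rule: multilinear_basis_induct)
      case (basis v \<kappa>)
      show ?case
      proof (cases "J = {}")
        case True
        then show ?thesis by (simp add: E_def W_def pairings_empty prob_space)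
      next
        case False
        then obtain i where i: "i \<in> J" by blast
        have mono: "E v K = expectation (\<lambda>\<omega>. \<Prod>b\<in>K. \<zeta> \<omega> $ \<kappa> b)" if "K \<subseteq> J" for K
          unfolding E_def using that basis
          by (intro Bochner_Integration.integral_cong prod.cong) (auto simp: inner_axis')
        have "E v J = (\<Sum>j\<in>J - {i}. E v {i, j} * E v (J - {i, j}))"
          using standard_gaussian_monomial_rec[OF z psubset(1) i, of \<kappa>] i
          by (subst mono; simp add: mono)
        also have "\<dots> = (\<Sum>j\<in>J - {i}. E v {i, j} * W v (J - {i, j}))"
          using i by (intro sum.cong refl arg_cong2[where f="(*)"] psubset(2)) auto
        also have "\<dots> = W v J" by (rule W_rec[OF psubset(1) i, symmetric])
        finally show ?thesis .
      qed
    next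
      case (expand v i)
      then show ?case
        by (subst E_expand[OF psubset(1) expand(1)], subst W_expand[OF psubset(1) expand(1)]) (simp only: expand(2))
    qed
  qed
  from this[OF I] show "expectation (\<lambda>\<omega>. \<Prod>i\<in>I. v i \<bullet> \<zeta> \<omega>) =
      (\<Sum>P\<in>pairings I. \<Prod>B\<in>P. expectation (\<lambda>\<omega>. \<Prod>b\<in>B. v b \<bullet> \<zeta> \<omega>))"
    by (simp add: E_def W_def)
qed

lemma gaussian_linear_forms_covariance:
  fixes \<zeta> :: "'a \<Rightarrow> real ^ 'n"
  assumes z: "standard_gaussian_vector M \<zeta>"
  shows "expectation (\<lambda>\<omega>. (u \<bullet> \<zeta> \<omega>) * (w \<bullet> \<zeta> \<omega>)) = u \<bullet> w"
proof -
  note cov = standard_gaussian_covariance[OF z]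
  have "expectation (\<lambda>\<omega>. (u \<bullet> \<zeta> \<omega>) * (w \<bullet> \<zeta> \<omega>)) =
      expectation (\<lambda>\<omega>. \<Sum>k\<in>UNIV. \<Sum>l\<in>UNIV. (u $ k * w $ l) * (\<zeta> \<omega> $ k * \<zeta> \<omega> $ l))"
    by (simp add: inner_vec_def sum_product ac_simps)
  also have "\<dots> = (\<Sum>k\<in>UNIV. \<Sum>l\<in>UNIV. (u $ k * w $ l) * (if k = l then 1 else 0))"
    by (simp add: cov del: mult_cancel_left1)
  also have "\<dots> = u \<bullet> w"
    by (simp add: inner_vec_def if_distrib cong: if_cong)
  finally show ?thesis .
qed

text \<open>
  The components of \<open>B \<zeta>\<close> are linear forms in \<open>\<zeta>\<close> given by the rows of \<open>B\<close>, and the inner products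
  of the rows are the entries of \<open>B B\<^sup>T\<close>. The right-hand side of Isserlis' theorem involves
  pairwise moments only, and in these \<open>B \<zeta>\<close> and \<open>Z\<close> agree.
\<close>

lemma isserlis_comp_prod:
  fixes \<zeta> :: "'a \<Rightarrow> real ^ 'n" and B :: "real ^ 'n ^ 'n" and Z :: "'b \<Rightarrow> real ^ 'n"
  assumes z: "standard_gaussian_vector M \<zeta>" and J: "finite J"
    and cov: "\<And>i j. (LINT \<omega>|M'. Z \<omega> $ i * Z \<omega> $ j) = (B ** transpose B) $ i $ j"
  shows "integrable M (\<lambda>\<omega>. comp_prod \<alpha> J (B *v \<zeta> \<omega>))"
    and "expectation (\<lambda>\<omega>. comp_prod \<alpha> J (B *v \<zeta> \<omega>)) = pairing_sum M' Z \<alpha> J"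
proof -
  have forms: "comp_prod \<alpha> K (B *v \<zeta> \<omega>) = (\<Prod>j\<in>K. B $ \<alpha> j \<bullet> \<zeta> \<omega>)" for K \<omega>
    by (simp add: comp_prod_def matrix_vector_mul_component)
  have block: "expectation (\<lambda>\<omega>. \<Prod>b\<in>D. B $ \<alpha> b \<bullet> \<zeta> \<omega>) = (LINT \<omega>|M'. comp_prod \<alpha> D (Z \<omega>))"
    if D2: "card D = 2" for D :: "nat set"
  proof -
    obtain a b where D: "D = {a, b}" "a \<noteq> b" using D2 by (auto simp: card_2_iff)
    have "expectation (\<lambda>\<omega>. \<Prod>b\<in>D. B $ \<alpha> b \<bullet> \<zeta> \<omega>) = B $ \<alpha> a \<bullet> B $ \<alpha> b"
      using D gaussian_linear_forms_covariance[OF z] by simp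
    also have "\<dots> = (B ** transpose B) $ \<alpha> a $ \<alpha> b"
      by (simp add: matrix_matrix_mult_def transpose_def inner_vec_def)
    also have "\<dots> = (LINT \<omega>|M'. comp_prod \<alpha> D (Z \<omega>))"
      using D by (simp add: comp_prod_def cov[symmetric])
    finally show ?thesis .
  qed
  show "integrable M (\<lambda>\<omega>. comp_prod \<alpha> J (B *v \<zeta> \<omega>))"
    unfolding forms by (rule integrable_gaussian_linear_forms[OF z J])
  show "expectation (\<lambda>\<omega>. comp_prod \<alpha> J (B *v \<zeta> \<omega>)) = pairing_sum M' Z \<alpha> J"
    unfolding forms isserlis[OF z J] pairing_sum_def
    by (intro sum.cong prod.cong refl block) (auto simp: pairings_def)
qed

end

section \<open>Moments of the generalized inverse Gaussian distribution\<close>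

lemma borel_measurable_cosh [measurable]: "(cosh :: real \<Rightarrow> real) \<in> borel_measurable borel"
  by (intro borel_measurable_continuous_onI continuous_intros)

text \<open>
  From \<open>cosh t \<ge> t\<^sup>2 / 4\<close>, completing the square bounds the integrand by a multiple of a normal
  density with mean \<open>2 \<nu> / z\<close> and variance \<open>2 / z\<close>.
\<close>

lemma integrable_exp_neg_cosh:
  fixes z \<nu> :: real
  assumes z: "z > 0"
  shows "integrable lborel (\<lambda>t. exp (\<nu> * t - z * cosh t))"
proof (rule Bochner_Integration.integrable_bound)
  define s where "s = sqrt (2 / z)"
  define C where "C = exp (\<nu>\<^sup>2 / z) * sqrt (2 * pi * s\<^sup>2)"
  have s: "s > 0" and s_sq: "s\<^sup>2 = 2 / z" using z by (simp_all add: s_def)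
  show "integrable lborel (\<lambda>t. C * normal_density (2 * \<nu> / z) s t)"
    using integrable_normal_moment[OF s, of "2 * \<nu> / z" 0] by simp
  show "AE t in lborel. norm (exp (\<nu> * t - z * cosh t)) \<le> norm (C * normal_density (2 * \<nu> / z) s t)"
  proof (intro AE_I2)
    fix t :: real
    have "t\<^sup>2 / 2 \<le> exp \<bar>t\<bar>"
      using exp_lower_Taylor_quadratic[of "\<bar>t\<bar>"] by simp
    also have "\<dots> \<le> 2 * cosh t"
      by (cases "t \<ge> 0") (simp_all add: cosh_def)
    finally have "z * (t\<^sup>2 / 4) \<le> z * cosh t"
      using z by simp
    then have "\<nu> * t - z * cosh t \<le> \<nu> * t - z * (t\<^sup>2 / 4)"
      by simp
    also have "\<dots> = \<nu>\<^sup>2 / z - (t - 2 * \<nu> / z)\<^sup>2 / (2 * s\<^sup>2)"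
      unfolding s_sq using z by (simp add: field_simps power2_eq_square)
    finally have "exp (\<nu> * t - z * cosh t) \<le> exp (\<nu>\<^sup>2 / z) * exp (- (t - 2 * \<nu> / z)\<^sup>2 / (2 * s\<^sup>2))"
      by (simp add: exp_add[symmetric])
    also have "\<dots> = C * normal_density (2 * \<nu> / z) s t"
      using s by (simp add: C_def normal_density_def)
    finally show "norm (exp (\<nu> * t - z * cosh t)) \<le> norm (C * normal_density (2 * \<nu> / z) s t)"
      by simp
  qed
qed measurable

text \<open>
  The half-line integral defining \<open>bessel_K\<close> is the fold of a full-line integral at the origin: the
  hyperbolic cosine in its integrand arises from adding the contributions of \<open>t\<close> and \<open>-t\<close>.
\<close>

lemma integral_exp_neg_cosh:
  fixes z \<nu> :: real
  assumes z: "z > 0"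
  shows "(LINT t|lborel. exp (\<nu> * t - z * cosh t)) = 2 * bessel_K \<nu> z"
proof -
  define f where "f t = exp (\<nu> * t - z * cosh t)" for t
  define I where "I S = (LINT t|lborel. indicator S t * f t)" for S
  have int: "integrable lborel f" and intm: "integrable lborel (\<lambda>t. f (- t))"
    using integrable_exp_neg_cosh[OF z, of \<nu>] integrable_exp_neg_cosh[OF z, of "- \<nu>"]
    by (simp_all add: f_def[abs_def])
  have int_ind: "integrable lborel (\<lambda>t. indicator S t * f t)"
      "integrable lborel (\<lambda>t. indicator S t * f (- t))" if "S \<in> sets lborel" for S
    using integrable_mult_indicator[OF that int] integrable_mult_indicator[OF that intm] by auto
  have "(LINT t|lborel. f t) = (LINT t|lborel. indicator {0..} t * f t + indicator {..<0} t * f t)"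
    by (intro Bochner_Integration.integral_cong) (auto simp: indicator_def)
  also have "\<dots> = I {0..} + I {..<0}"
    unfolding I_def by (intro Bochner_Integration.integral_add int_ind) auto
  also have "I {..<0} = (LINT t|lborel. indicator {..<0} (- t) * f (- t))"
    unfolding I_def by (subst lborel_integral_real_affine[of "-1" _ 0]) simp_all
  also have "\<dots> = (LINT t|lborel. indicator {0..} t * f (- t))"
  proof (rule integral_cong_AE)
    show "AE t in lborel. indicator {..<0} (- t) * f (- t) = indicator {0..} t * f (- t)"
      using AE_lborel_singleton[of 0] by eventually_elim (auto simp: indicator_def)
  qed (unfold f_def, measurable)
  also have "I {0..} + \<dots> = (LINT t|lborel. indicator {0..} t * f t + indicator {0..} t * f (- t))"
    unfolding I_def by (intro Bochner_Integration.integral_add[symmetric] int_ind) auto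
  also have "\<dots> = (LINT t|lborel. 2 * (indicator {0..} t *\<^sub>R (exp (- z * cosh t) * cosh (\<nu> * t))))"
  proof (rule Bochner_Integration.integral_cong)
    fix t
    have "f t + f (- t) = 2 * (exp (- z * cosh t) * cosh (\<nu> * t))"
      by (simp add: f_def cosh_def[of "\<nu> * t"] exp_diff exp_minus field_simps)
    then show "indicator {0..} t * f t + indicator {0..} t * f (- t) =
        2 * (indicator {0..} t *\<^sub>R (exp (- z * cosh t) * cosh (\<nu> * t)))"
      by (simp add: indicator_def)
  qed simp
  also have "\<dots> = 2 * bessel_K \<nu> z"
    by (simp add: bessel_K_def set_lebesgue_integral_def)
  finally show ?thesis by (simp add: f_def)
qed

lemma bessel_K_nonneg: "bessel_K \<nu> z \<ge> 0"
  unfolding bessel_K_def set_lebesgue_integral_def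
  by (intro Bochner_Integration.integral_nonneg) (auto intro!: mult_nonneg_nonneg)

text \<open>
  With \<open>c = sqrt (chi / psi)\<close> the substitution \<open>x = c exp t\<close> balances the two exponential terms:
  both \<open>chi / c\<close> and \<open>psi c\<close> equal \<open>z = sqrt (psi chi)\<close>, whence the exponent becomes
  \<open>- z cosh t\<close>, while \<open>x powr (a - 1)\<close> and the Jacobian combine to \<open>c powr a * exp (a t)\<close>.
\<close>

lemma gig_kernel_integral:
  fixes psi chi a :: real
  assumes "psi > 0" "chi > 0"
  shows "has_bochner_integral lborel
     (\<lambda>x. indicator {0<..} x * (x powr (a - 1) * exp (- (1 / 2) * (chi * inverse x + psi * x))))
     (2 * (psi / chi) powr (- a / 2) * bessel_K a (sqrt (psi * chi)))"
proof -
  define c where "c = sqrt (chi / psi)"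
  define z where "z = sqrt (psi * chi)"
  define f where "f x = x powr (a - 1) * exp (- (1 / 2) * (chi * inverse x + psi * x))" for x
  define b where "b = 2 * (psi / chi) powr (- a / 2) * bessel_K a z"
  have c: "c > 0" and z: "z > 0" using assms by (simp_all add: c_def z_def)
  have cz: "psi * c = z" "chi / c = z"
    using assms by (simp_all add: c_def z_def real_sqrt_divide real_sqrt_mult field_simps)
  have c_powr: "c powr a = (psi / chi) powr (- a / 2)"
  proof -
    have "c = (psi / chi) powr (- 1 / 2)"
      using assms by (simp add: c_def powr_minus powr_half_sqrt real_sqrt_divide)
    then show ?thesis by (simp add: powr_powr)
  qed
  have pullback: "\<bar>c * exp t\<bar> * f (c * exp t) = c powr a * exp (a * t - z * cosh t)" for t
  proof -
    have "\<bar>c * exp t\<bar> * f (c * exp t) =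
        (c * exp t) powr a * exp (- (1 / 2) * (chi / c * exp (- t) + psi * c * exp t))"
      using c by (simp add: f_def powr_diff exp_minus field_simps)
    also have "- (1 / 2) * (chi / c * exp (- t) + psi * c * exp t) = - (z * cosh t)"
      unfolding cz by (simp add: cosh_def algebra_simps)
    also have "(c * exp t) powr a = c powr a * exp (a * t)"
      using c by (simp add: powr_mult exp_powr_real mult.commute)
    finally show ?thesis by (simp add: exp_diff exp_minus divide_inverse)
  qed
  have h: "integrable lborel (\<lambda>t. c powr a * exp (a * t - z * cosh t))"
    using integrable_exp_neg_cosh[OF z, of a] by simp
  have h_int: "(LINT t|lborel. c powr a * exp (a * t - z * cosh t)) = b"
    by (simp add: integral_exp_neg_cosh[OF z] b_def c_powr)
  have "(\<lambda>t. \<bar>c * exp t\<bar> * f (c * exp t)) absolutely_integrable_on UNIV \<and>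
      integral UNIV (\<lambda>t. \<bar>c * exp t\<bar> * f (c * exp t)) = b"
    unfolding pullback using h h_int
    by (auto simp: set_integrable_def integrable_completion integral_lborel)
  moreover have "range (\<lambda>t. c * exp t) = {0<..}"
  proof (intro equalityI subsetI)
    fix x :: real assume "x \<in> {0<..}"
    then have "x = c * exp (ln (x / c))" using c by simp
    then show "x \<in> range (\<lambda>t. c * exp t)" by blast
  qed (use c in auto)
  moreover have "inj (\<lambda>t. c * exp t)" using c by (auto intro!: injI)
  moreover have "((\<lambda>t. c * exp t) has_real_derivative c * exp t) (at t)" for t
    by (auto intro!: derivative_eq_intros)
  ultimately have f: "f absolutely_integrable_on {0<..}" "integral {0<..} f = b"
    using has_absolute_integral_change_of_variables_1'[of UNIV "\<lambda>t. c * exp t" "\<lambda>t. c * exp t" f b]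
    by auto
  have meas: "(\<lambda>x. indicator {0<..} x * f x) \<in> borel_measurable lborel"
    unfolding f_def by measurable
  have "integrable lborel (\<lambda>x. indicator {0<..} x * f x)"
    using f(1) meas by (simp add: set_integrable_def integrable_completion)
  moreover have "(LINT x|lborel. indicator {0<..} x * f x) = b"
    using set_lebesgue_integral_eq_integral(2)[OF f(1)] f(2) meas
    by (simp add: set_lebesgue_integral_def integral_completion)
  ultimately show ?thesis
    by (simp add: has_bochner_integral_iff f_def b_def z_def)
qed

lemma gig_moments:
  fixes Y :: "'a \<Rightarrow> real"
  assumes params: "psi > 0" "chi > 0"
    and Y: "distributed M lborel Y (\<lambda>x. ennreal (gig_density psi chi lam x))"
  shows "has_bochner_integral M (\<lambda>\<omega>. Y \<omega> ^ l) (gig_moment psi chi lam l)"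
proof -
  define C where "C = (psi / chi) powr (lam / 2) / (2 * bessel_K lam (sqrt (psi * chi)))"
  define z where "z = sqrt (psi * chi)"
  let ?a = "lam + real l"
  have nonneg: "gig_density psi chi lam x \<ge> 0" for x
    by (simp add: gig_density_def bessel_K_nonneg)
  have eq: "gig_density psi chi lam x * x ^ l = C * (indicator {0<..} x *
      (x powr (?a - 1) * exp (- (1 / 2) * (chi * inverse x + psi * x))))" for x
    by (cases "x > 0")
       (simp_all add: gig_density_def C_def powr_realpow[symmetric] powr_add[symmetric] algebra_simps
          flip: powr_add)
  have "C * (2 * (psi / chi) powr (- ?a / 2) * bessel_K ?a z) =
      (psi / chi) powr (lam / 2) * (psi / chi) powr (- ?a / 2) * (bessel_K ?a z / bessel_K lam z)"
    by (simp add: C_def z_def)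
  also have "\<dots> = gig_moment psi chi lam l"
    by (simp add: gig_moment_def z_def field_simps flip: powr_add)
  finally have "has_bochner_integral lborel (\<lambda>x. gig_density psi chi lam x * x ^ l) (gig_moment psi chi lam l)"
    unfolding eq using has_bochner_integral_mult_right[OF gig_kernel_integral[OF params, of ?a], of C]
    by (simp add: z_def)
  then show ?thesis
    using distributed_integrable[OF Y, of "\<lambda>x. x ^ l"] distributed_integral[OF Y, of "\<lambda>x. x ^ l"] nonneg
    by (simp add: has_bochner_integral_iff)
qed

section \<open>Expanding the product\<close>

lemma sum_nested_subsets:
  fixes F :: "'i set \<Rightarrow> 'i set \<Rightarrow> 'c::comm_monoid_add"
  assumes "finite A"
  shows "(\<Sum>S\<in>Pow A. \<Sum>T\<in>Pow S. F T S) = (\<Sum>(T, S)\<in>{(T, S). T \<subseteq> S \<and> S \<subseteq> A}. F T S)"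
proof -
  have "(\<Sum>S\<in>Pow A. \<Sum>T\<in>Pow S. F T S) = (\<Sum>(S, T)\<in>Sigma (Pow A) Pow. F T S)"
    using assms by (intro sum.Sigma) (auto intro: finite_subset)
  also have "\<dots> = (\<Sum>(T, S)\<in>{(T, S). T \<subseteq> S \<and> S \<subseteq> A}. F T S)"
    by (rule sum.reindex_bij_witness[of _ prod.swap prod.swap]) auto
  finally show ?thesis .
qed

lemma comp_prod_mixture_expand:
  assumes A: "finite A"
  shows "comp_prod \<alpha> A (\<mu> + s\<^sup>2 *\<^sub>R \<gamma> + s *\<^sub>R w) =
    (\<Sum>(T, S)\<in>{(T, S). T \<subseteq> S \<and> S \<subseteq> A}.
       comp_prod \<alpha> T \<mu> * comp_prod \<alpha> (S - T) \<gamma> *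
       (s ^ (2 * card (S - T) + card (A - S)) * comp_prod \<alpha> (A - S) w))"
proof -
  have "comp_prod \<alpha> A (\<mu> + s\<^sup>2 *\<^sub>R \<gamma> + s *\<^sub>R w) =
      (\<Prod>i\<in>A. (\<mu> $ \<alpha> i + s\<^sup>2 * \<gamma> $ \<alpha> i) + s * w $ \<alpha> i)"
    by (simp add: comp_prod_def)
  also have "\<dots> = (\<Sum>S\<in>Pow A. (\<Sum>T\<in>Pow S. (\<Prod>i\<in>T. \<mu> $ \<alpha> i) * (\<Prod>i\<in>S - T. s\<^sup>2 * \<gamma> $ \<alpha> i)) *
      (\<Prod>i\<in>A - S. s * w $ \<alpha> i))"
    unfolding prod_add[OF A]
    by (intro sum.cong refl arg_cong2[where f="(*)"] prod_add) (use A in \<open>auto intro: finite_subset\<close>)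
  also have "\<dots> = (\<Sum>S\<in>Pow A. \<Sum>T\<in>Pow S. comp_prod \<alpha> T \<mu> * comp_prod \<alpha> (S - T) \<gamma> *
      (s ^ (2 * card (S - T) + card (A - S)) * comp_prod \<alpha> (A - S) w))"
    unfolding sum_distrib_right
    by (intro sum.cong refl)
       (simp add: comp_prod_def prod.distrib power_add power_mult mult.assoc mult.left_commute)
  finally show ?thesis unfolding sum_nested_subsets[OF A] .
qed

text \<open>
  If the complement of \<open>S\<close> has even size, then \<open>S\<close> and \<open>A\<close> have sizes of the same
  parity \<open>\<epsilon>\<close>. The sum can then be taken over the fibres of the map sending \<open>(T, S)\<close> to
  \<open>((card S - \<epsilon>) div 2, card T)\<close>.
\<close>

lemma sum_nested_subsets_by_card:
  fixes F :: "'i set \<times> 'i set \<Rightarrow> 'c::comm_monoid_add"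
  assumes A: "finite A" "card A = 2 * N + \<epsilon>" and eps: "\<epsilon> \<in> {0, 1}"
    and odd: "\<And>T S. T \<subseteq> S \<Longrightarrow> S \<subseteq> A \<Longrightarrow> odd (card (A - S)) \<Longrightarrow> F (T, S) = 0"
  shows "(\<Sum>x\<in>{(T, S). T \<subseteq> S \<and> S \<subseteq> A}. F x) =
    (\<Sum>l\<in>{0..N}. \<Sum>p\<in>{0..2 * l + \<epsilon>}.
       \<Sum>x\<in>{(T, S). T \<subseteq> S \<and> S \<subseteq> A \<and> card T = p \<and> card S = 2 * l + \<epsilon>}. F x)"
proof -
  define Q where "Q = {(T, S). T \<subseteq> S \<and> S \<subseteq> A \<and> even (card (A - S))}"
  define key where "key = (\<lambda>(T :: 'i set, S :: 'i set). ((card S - \<epsilon>) div 2, card T))"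
  have fin: "finite {(T, S). T \<subseteq> S \<and> S \<subseteq> A}"
    by (rule finite_subset[of _ "Pow A \<times> Pow A"]) (use A in auto)
  have finQ: "finite Q" by (rule finite_subset[OF _ fin]) (auto simp: Q_def)
  have card_S: "card S = 2 * ((card S - \<epsilon>) div 2) + \<epsilon>" "(card S - \<epsilon>) div 2 \<le> N" "card T \<le> card S"
    if "(T, S) \<in> Q" for T S
  proof -
    have sub: "T \<subseteq> S" "S \<subseteq> A" "even (card (A - S))" using that by (auto simp: Q_def)
    then have le: "card S \<le> card A" "card (A - S) = card A - card S" "finite S"
      using A card_mono[OF A(1) sub(2)] finite_subset[OF sub(2) A(1)]
      by (simp_all add: card_Diff_subset)
    then have par: "even (card S) \<longleftrightarrow> \<epsilon> = 0" using sub A eps by auto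
    then show "card S = 2 * ((card S - \<epsilon>) div 2) + \<epsilon>" using eps by (auto elim!: oddE)
    show "(card S - \<epsilon>) div 2 \<le> N" using le A by simp
    show "card T \<le> card S" using sub le by (simp add: card_mono)
  qed
  have fibre: "{x \<in> Q. key x = (l, p)} =
      {(T, S). T \<subseteq> S \<and> S \<subseteq> A \<and> card T = p \<and> card S = 2 * l + \<epsilon>}" for l p
  proof (intro equalityI subsetI)
    fix x assume "x \<in> {x \<in> Q. key x = (l, p)}"
    then show "x \<in> {(T, S). T \<subseteq> S \<and> S \<subseteq> A \<and> card T = p \<and> card S = 2 * l + \<epsilon>}"
      using card_S(1)[of "fst x" "snd x"] by (auto simp: key_def Q_def split: prod.splits)
  next
    fix x assume x: "x \<in> {(T, S). T \<subseteq> S \<and> S \<subseteq> A \<and> card T = p \<and> card S = 2 * l + \<epsilon>}"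
    then obtain T S where TS: "x = (T, S)" "T \<subseteq> S" "S \<subseteq> A" "card T = p" "card S = 2 * l + \<epsilon>" by auto
    then have "card (A - S) = 2 * N + \<epsilon> - (2 * l + \<epsilon>)"
      using A by (simp add: card_Diff_subset finite_subset)
    then show "x \<in> {x \<in> Q. key x = (l, p)}" using TS by (auto simp: key_def Q_def)
  qed
  have "(\<Sum>x\<in>{(T, S). T \<subseteq> S \<and> S \<subseteq> A}. F x) = sum F Q"
    by (rule sum.mono_neutral_right[OF fin]) (auto simp: Q_def intro: odd)
  also have "\<dots> = (\<Sum>y\<in>Sigma {0..N} (\<lambda>l. {0..2 * l + \<epsilon>}). \<Sum>x\<in>{x \<in> Q. key x = y}. F x)"
  proof (rule sum.group[symmetric, OF finQ])
    show "key ` Q \<subseteq> Sigma {0..N} (\<lambda>l. {0..2 * l + \<epsilon>})"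
      using card_S by (fastforce simp: key_def)
  qed auto
  also have "\<dots> = (\<Sum>l\<in>{0..N}. \<Sum>p\<in>{0..2 * l + \<epsilon>}. \<Sum>x\<in>{x \<in> Q. key x = (l, p)}. F x)"
    by (subst sum.Sigma) (auto intro!: sum.cong)
  finally show ?thesis unfolding fibre .
qed

section \<open>Moments of the mixture\<close>

context prob_space begin

text \<open>
  The transition from independence of variables with values in different types to
  \<open>indep_var\<close>, in which both variables have values in the same type: measurable maps into a
  common space shrink the generated \<open>\<sigma>\<close>-algebras.
\<close>

lemma indep_rvs_compose:
  assumes XY: "indep_rvs M S X T Y" and f: "f \<in> measurable S N" and g: "g \<in> measurable T N"
  shows "indep_var N (\<lambda>\<omega>. f (X \<omega>)) N (\<lambda>\<omega>. g (Y \<omega>))"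
proof -
  have rv: "X \<in> measurable M S" "Y \<in> measurable M T"
    and indep: "indep_set {X -` B \<inter> space M | B. B \<in> sets S} {Y -` B \<inter> space M | B. B \<in> sets T}"
    using XY by (auto simp: indep_rvs_def)
  have pull: "{(\<lambda>\<omega>. h (U \<omega>)) -` B \<inter> space M | B. B \<in> sets N} \<subseteq> {U -` B \<inter> space M | B. B \<in> sets R}"
    if "U \<in> measurable M R" "h \<in> measurable R N" for U :: "'a \<Rightarrow> 'x" and h R
  proof safe
    fix B assume "B \<in> sets N"
    then show "\<exists>C. (\<lambda>\<omega>. h (U \<omega>)) -` B \<inter> space M = U -` C \<inter> space M \<and> C \<in> sets R"
      using that by (intro exI[of _ "h -` B \<inter> space R"]) (auto dest: measurable_space)
  qed
  show ?thesis
    unfolding indep_var_eq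
  proof (intro conjI indep_set_sigma_sets)
    show "indep_set {(\<lambda>\<omega>. f (X \<omega>)) -` B \<inter> space M | B. B \<in> sets N}
        {(\<lambda>\<omega>. g (Y \<omega>)) -` B \<inter> space M | B. B \<in> sets N}"
      using indep pull[OF rv(1) f] pull[OF rv(2) g]
      unfolding indep_set_def by (elim indep_sets_mono_sets) (auto split: bool.split)
  next
    have int_stable: "Int_stable {U -` B \<inter> space M | B. B \<in> sets N}" for U
    proof (safe intro!: Int_stableI)
      fix B C assume "B \<in> sets N" "C \<in> sets N"
      then show "\<exists>D. (U -` B \<inter> space M) \<inter> (U -` C \<inter> space M) = U -` D \<inter> space M \<and> D \<in> sets N"
        by (intro exI[of _ "B \<inter> C"]) auto
    qed
    show "Int_stable {(\<lambda>\<omega>. f (X \<omega>)) -` B \<inter> space M | B. B \<in> sets N}"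
      by (rule int_stable)
    show "Int_stable {(\<lambda>\<omega>. g (Y \<omega>)) -` B \<inter> space M | B. B \<in> sets N}"
      by (rule int_stable)
  qed (use rv f g in \<open>auto intro: measurable_compose\<close>)
qed
end

theorem theorem4:
  fixes M :: "'a measure" and M' :: "'b measure"
    and X \<zeta> :: "'a \<Rightarrow> real ^ 'd" and \<sigma> :: "'a \<Rightarrow> real"
    and Z :: "'b \<Rightarrow> real ^ 'd"
    and \<mu> \<beta> \<gamma> :: "real ^ 'd" and \<Delta> :: "real ^ 'd ^ 'd"
    and psi chi lam :: real
    and N \<epsilon> :: nat and \<alpha> :: "nat \<Rightarrow> 'd" and A :: "nat set"
  assumes M: "prob_space M"
    and Delta: "sym_pos_def \<Delta>" "det \<Delta> = 1"
    and zeta: "standard_gaussian_vector M \<zeta>"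
    and sigma: "\<sigma> \<in> borel_measurable M" "AE \<omega> in M. \<sigma> \<omega> > 0"
    and params: "psi > 0" "chi > 0"
    and gig: "distributed M lborel (\<lambda>\<omega>. (\<sigma> \<omega>)\<^sup>2) (\<lambda>x. ennreal (gig_density psi chi lam x))"
    and indep: "indep_rvs M borel (\<lambda>\<omega>. (\<sigma> \<omega>)\<^sup>2) borel \<zeta>"
    and X: "\<And>\<omega>. X \<omega> = \<mu> + (\<sigma> \<omega>)\<^sup>2 *\<^sub>R (\<Delta> *v \<beta>) + \<sigma> \<omega> *\<^sub>R (matrix_sqrt \<Delta> *v \<zeta> \<omega>)"
    and M': "prob_space M'"
    and Z: "centered_gaussian_vector M' Z \<Delta>"
    and gamma: "\<gamma> = \<Delta> *v \<beta>"
    and eps: "\<epsilon> \<in> {0, 1}"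
    and A: "A = {1..2 * N + \<epsilon>}"
  shows "(\<forall>l. integrable M (\<lambda>\<omega>. \<sigma> \<omega> ^ (2 * l)) \<and>
              (LINT \<omega>|M. \<sigma> \<omega> ^ (2 * l)) = gig_moment psi chi lam l) \<and>
         integrable M (\<lambda>\<omega>. comp_prod \<alpha> A (X \<omega>)) \<and>
         (LINT \<omega>|M. comp_prod \<alpha> A (X \<omega>)) =
           (\<Sum>l\<in>{0..N}. \<Sum>p\<in>{0..2 * l + \<epsilon>}.
              \<Sum>(T, S)\<in>{(T, S). T \<subseteq> S \<and> S \<subseteq> A \<and> card T = p \<and> card S = 2 * l + \<epsilon>}.
                comp_prod \<alpha> T \<mu> * comp_prod \<alpha> (S - T) \<gamma>
                  * gig_moment psi chi lam (N + l + \<epsilon> - p)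
                  * pairing_sum M' Z \<alpha> (A - S))"
proof -
  interpret prob_space M by (rule M)
  define B where "B = matrix_sqrt \<Delta>"
  define K where "K J \<omega> = comp_prod \<alpha> J (B *v \<zeta> \<omega>)" for J \<omega>
  have "transpose B = B" "B ** B = \<Delta>"
    using sym_pos_def_matrix_sqrt[OF Delta(1)] matrix_sqrt_mult_self[OF Delta(1)]
    by (simp_all add: B_def sym_pos_def_def)
  then have cov: "(LINT \<omega>|M'. Z \<omega> $ i * Z \<omega> $ j) = (B ** transpose B) $ i $ j" for i j
    using Z by (simp add: centered_gaussian_vector_def)
  have moment: "has_bochner_integral M (\<lambda>\<omega>. \<sigma> \<omega> ^ (2 * l)) (gig_moment psi chi lam l)" for l
    using gig_moments[OF params gig, of l] by (simp add: power_mult)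

  \<comment> \<open>Odd powers of \<open>\<sigma>\<close> also occur; their moments are multiplied by zero in the end, but
      they must be finite.\<close>
  have int_abs: "integrable M (\<lambda>\<omega>. \<bar>\<sigma> \<omega>\<bar> ^ n)" for n
  proof (rule Bochner_Integration.integrable_bound)
    show "integrable M (\<lambda>\<omega>. 1 + \<sigma> \<omega> ^ (2 * n))"
      using moment[of n] by (auto simp: has_bochner_integral_iff)
    show "AE \<omega> in M. norm (\<bar>\<sigma> \<omega>\<bar> ^ n) \<le> norm (1 + \<sigma> \<omega> ^ (2 * n))"
    proof (intro AE_I2)
      fix \<omega>
      define x where "x = \<bar>\<sigma> \<omega>\<bar> ^ n"
      have "x \<ge> 0" by (simp add: x_def)
      then have "x \<le> 1 + x\<^sup>2"
        using zero_le_power2[of "x - 1"] by (simp add: power2_eq_square algebra_simps)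
      moreover have "x\<^sup>2 = \<sigma> \<omega> ^ (2 * n)"
        by (simp add: x_def power_mult[symmetric] mult.commute[of n] power_even_abs)
      ultimately show "norm (\<bar>\<sigma> \<omega>\<bar> ^ n) \<le> norm (1 + \<sigma> \<omega> ^ (2 * n))"
        by (simp add: x_def)
    qed
  qed (use sigma in measurable)
  have factor: "integrable M (\<lambda>\<omega>. \<sigma> \<omega> ^ n * K J \<omega>)"
      "expectation (\<lambda>\<omega>. \<sigma> \<omega> ^ n * K J \<omega>) = expectation (\<lambda>\<omega>. \<sigma> \<omega> ^ n) * pairing_sum M' Z \<alpha> J"
    if J: "finite J" for n J
  proof -
    note K = isserlis_comp_prod[OF zeta J cov, of \<alpha>, folded K_def]
    have meas: "(\<lambda>v. comp_prod \<alpha> J (B *v v)) \<in> borel_measurable borel"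
      unfolding comp_prod_def matrix_vector_mul_component
      by (intro borel_measurable_continuous_onI continuous_intros)
    \<comment> \<open>Independence is given for \<open>\<sigma>\<^sup>2\<close> only, so it first yields the claim for the
        absolute value of \<open>\<sigma>\<close>.\<close>
    have "indep_var borel (\<lambda>\<omega>. sqrt ((\<sigma> \<omega>)\<^sup>2) ^ n) borel (\<lambda>\<omega>. comp_prod \<alpha> J (B *v \<zeta> \<omega>))"
      by (rule indep_rvs_compose[OF indep, of "\<lambda>x. sqrt x ^ n"]) (use meas in auto)
    then have iv: "indep_var borel (\<lambda>\<omega>. \<bar>\<sigma> \<omega>\<bar> ^ n) borel (K J)"
      by (simp add: K_def[abs_def])
    have K_meas: "K J \<in> borel_measurable M" using K(1) by auto
    have eq: "AE \<omega> in M. \<bar>\<sigma> \<omega>\<bar> ^ n * K J \<omega> = \<sigma> \<omega> ^ n * K J \<omega>"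
      "AE \<omega> in M. \<bar>\<sigma> \<omega>\<bar> ^ n = \<sigma> \<omega> ^ n"
      using sigma(2) by (auto elim: eventually_mono)
    show "integrable M (\<lambda>\<omega>. \<sigma> \<omega> ^ n * K J \<omega>)"
      using indep_var_integrable[OF iv int_abs K(1)] eq(1) K_meas sigma(1)
      by (subst integrable_cong_AE[symmetric]) auto
    have "expectation (\<lambda>\<omega>. \<sigma> \<omega> ^ n * K J \<omega>) = expectation (\<lambda>\<omega>. \<bar>\<sigma> \<omega>\<bar> ^ n * K J \<omega>)"
      using eq(1) K_meas sigma(1) by (intro integral_cong_AE) auto
    also have "\<dots> = expectation (\<lambda>\<omega>. \<bar>\<sigma> \<omega>\<bar> ^ n) * pairing_sum M' Z \<alpha> J"
      using indep_var_lebesgue_integral[OF iv int_abs K(1)] K(2) by simp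
    also have "expectation (\<lambda>\<omega>. \<bar>\<sigma> \<omega>\<bar> ^ n) = expectation (\<lambda>\<omega>. \<sigma> \<omega> ^ n)"
      using eq(2) sigma(1) by (intro integral_cong_AE) auto
    finally show "expectation (\<lambda>\<omega>. \<sigma> \<omega> ^ n * K J \<omega>) =
        expectation (\<lambda>\<omega>. \<sigma> \<omega> ^ n) * pairing_sum M' Z \<alpha> J" .
  qed

  have finA: "finite A" and cardA: "card A = 2 * N + \<epsilon>" by (simp_all add: A)
  define F where "F = (\<lambda>(T, S). comp_prod \<alpha> T \<mu> * comp_prod \<alpha> (S - T) \<gamma> *
      (expectation (\<lambda>\<omega>. \<sigma> \<omega> ^ (2 * card (S - T) + card (A - S))) * pairing_sum M' Z \<alpha> (A - S)))"
  define G where "G = (\<lambda>(T, S) \<omega>. comp_prod \<alpha> T \<mu> * comp_prod \<alpha> (S - T) \<gamma> *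
      (\<sigma> \<omega> ^ (2 * card (S - T) + card (A - S)) * K (A - S) \<omega>))"
  have G: "integrable M (G x)" "expectation (G x) = F x" for x
    using finA by (cases x; simp add: F_def G_def factor)+
  have expand: "comp_prod \<alpha> A (X \<omega>) = (\<Sum>x\<in>{(T, S). T \<subseteq> S \<and> S \<subseteq> A}. G x \<omega>)" for \<omega>
    unfolding X K_def B_def gamma[symmetric] G_def comp_prod_mixture_expand[OF finA]
    by (intro sum.cong) auto
  have int: "integrable M (\<lambda>\<omega>. comp_prod \<alpha> A (X \<omega>))"
    unfolding expand by (intro Bochner_Integration.integrable_sum G)
  have "expectation (\<lambda>\<omega>. comp_prod \<alpha> A (X \<omega>)) = (\<Sum>x\<in>{(T, S). T \<subseteq> S \<and> S \<subseteq> A}. F x)"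
    unfolding expand by (simp add: Bochner_Integration.integral_sum G)
  also have "\<dots> = (\<Sum>l\<in>{0..N}. \<Sum>p\<in>{0..2 * l + \<epsilon>}.
       \<Sum>x\<in>{(T, S). T \<subseteq> S \<and> S \<subseteq> A \<and> card T = p \<and> card S = 2 * l + \<epsilon>}. F x)"
    by (rule sum_nested_subsets_by_card[OF finA cardA eps])
       (use finA in \<open>auto simp: F_def pairing_sum_def pairings_odd\<close>)
  also have "\<dots> = (\<Sum>l\<in>{0..N}. \<Sum>p\<in>{0..2 * l + \<epsilon>}.
       \<Sum>(T, S)\<in>{(T, S). T \<subseteq> S \<and> S \<subseteq> A \<and> card T = p \<and> card S = 2 * l + \<epsilon>}.
         comp_prod \<alpha> T \<mu> * comp_prod \<alpha> (S - T) \<gamma>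
           * gig_moment psi chi lam (N + l + \<epsilon> - p) * pairing_sum M' Z \<alpha> (A - S))"
  proof (intro sum.cong refl)
    fix l p x
    assume l: "l \<in> {0..N}" and p: "p \<in> {0..2 * l + \<epsilon>}"
      and "x \<in> {(T, S). T \<subseteq> S \<and> S \<subseteq> A \<and> card T = p \<and> card S = 2 * l + \<epsilon>}"
    then obtain T S where x: "x = (T, S)" "T \<subseteq> S" "S \<subseteq> A" "card T = p" "card S = 2 * l + \<epsilon>"
      by auto
    have "finite S" "finite T" using x finA by (auto intro: finite_subset)
    then have "2 * card (S - T) + card (A - S) = 2 * (N + l + \<epsilon> - p)"
      using x l p cardA by (simp add: card_Diff_subset)
    then show "F x = (case x of (T, S) \<Rightarrow> comp_prod \<alpha> T \<mu> * comp_prod \<alpha> (S - T) \<gamma>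
           * gig_moment psi chi lam (N + l + \<epsilon> - p) * pairing_sum M' Z \<alpha> (A - S))"
      using has_bochner_integral_integral_eq[OF moment[of "N + l + \<epsilon> - p"]]
      by (simp add: F_def x(1))
  qed
  finally show ?thesis
    using moment int by (simp add: has_bochner_integral_iff)
qed

end
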